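(* Let $I_0=1$, $I_1=\log 2$, and for $k\ge2$ let $$I_k=\int_{[0,1]^k}\frac{{\rm d}x_1\,{\rm d}x_2\cdots{\rm d}x_k}{1+x_1(1+x_2(\cdots(1+x_k)\cdots))}.$$ Then $I_k=e^{-\gamma}+O(2^{-k})$, where $\gamma$ is the Euler--Mascheroni constant.
   Context: The implied constant is absolute. *)

theory Defs
  imports "HOL-Analysis.Analysis"
begin

text \<open>
  \<open>nested_denom k x\<close> is \<open>1 + x\<^sub>1 (1 + x\<^sub>2 (\<dots> (1 + x\<^sub>k) \<dots>))\<close>;
  only the coordinates \<open>x 1, \<dots>, x k\<close> matter.
\<close>

definition nested_denom :: "nat \<Rightarrow> (nat \<Rightarrow> real) \<Rightarrow> real" where
  "nested_denom k x = foldr (\<lambda>i t. 1 + x i * t) [1..<Suc k] 1"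

lemma nested_denom_2: "nested_denom 2 x = 1 + x 1 * (1 + x 2)"
  by (simp add: nested_denom_def numeral_2_eq_2)

lemma nested_denom_3: "nested_denom 3 x = 1 + x 1 * (1 + x 2 * (1 + x 3))"
  by (simp add: nested_denom_def numeral_3_eq_3 numeral_2_eq_2)

text \<open>
  Points of the \<open>k\<close>-dimensional space are extensional functions on \<open>{1..k}\<close>, carrying the
  \<open>k\<close>-fold product of the one-dimensional Lebesgue--Borel measure.
\<close>

definition I :: "nat \<Rightarrow> real" where
  "I k = (if k = 0 then 1
          else if k = 1 then ln 2
          else (LINT x:({1..k} \<rightarrow>\<^sub>E {0..1})|(\<Pi>\<^sub>M i\<in>{1..k}. lborel). 1 / nested_denom k x))"

end

theory Submission
  imports Defs "HOL-Real_Asymp.Real_Asymp"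
begin

text \<open>
  Write \<open>D\<^sub>k = 1 + x\<^sub>1 D\<^sub>k\<^sub>-\<^sub>1(x\<^sub>2, \<dots>)\<close> for the nested denominator at a uniformly random point of the
  cube. Its Laplace transform \<open>g\<^sub>k(s) = E exp (- s D\<^sub>k)\<close> satisfies
  \<open>g\<^sub>k(s) = exp (- s) * (integral of g\<^sub>k\<^sub>-\<^sub>1(s y) over y in [0,1])\<close>. A fixed point of this recursion is
  \<open>g(s) = exp (- s) h(s)\<close> with \<open>h = exp (- ein)\<close>, where \<open>ein\<close> is the entire exponential integral,
  because \<open>(s h(s))' = g(s)\<close>. The recursion halves the linear term in the estimate
  \<open>g(s) \<le> g\<^sub>k(s) \<le> exp (- s) (h(s) + s / 2^k)\<close>. Since \<open>I\<^sub>k\<close> is the integral of \<open>g\<^sub>k\<close> over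
  \<open>[0, \<infinity>)\<close>, it exceeds the integral of \<open>g\<close> by at most \<open>2^-k\<close>, and the latter is
  \<open>lim s h(s) = exp (- \<gamma>)\<close> because \<open>ein s - ln s\<close> tends to \<open>\<gamma>\<close>.
\<close>

section \<open>The entire exponential integral\<close>

definition ein_kernel :: "real \<Rightarrow> real" where
  "ein_kernel t = (if t = 0 then 1 else (1 - exp (- t)) / t)"

text \<open>The oriented interval integral makes sense for negative \<open>x\<close> too, so
  \<open>ein\<close> has a two-sided derivative everywhere, including at 0.\<close>

definition ein :: "real \<Rightarrow> real" where
  "ein x = (LBINT t=0..x. ein_kernel t)"

lemma mult_ein_kernel: "x * ein_kernel x = 1 - exp (- x)"
  by (simp add: ein_kernel_def)

lemma isCont_ein_kernel: "isCont ein_kernel x"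
proof (cases "x = 0")
  case True
  \<comment> \<open>Up to sign, the kernel is the difference quotient of \<open>exp (- t)\<close> at
    0, so this derivative supplies its limit there.\<close>
  have "((\<lambda>t::real. exp (- t)) has_real_derivative -1) (at 0)"
    by (auto intro!: derivative_eq_intros)
  then have "(\<lambda>t::real. (exp (- t) - 1) / t) \<midarrow>0\<rightarrow> -1"
    by (simp add: has_field_derivative_iff)
  from tendsto_minus[OF this] have "(\<lambda>t::real. - ((exp (- t) - 1) / t)) \<midarrow>0\<rightarrow> 1"
    by simp
  then have "ein_kernel \<midarrow>0\<rightarrow> 1"
    by (rule Lim_transform_eventually) (auto simp: eventually_at_filter ein_kernel_def field_simps)
  with True show ?thesis
    by (simp add: isCont_def ein_kernel_def)
next
  case False
  have "isCont (\<lambda>t. (1 - exp (- t)) / t) x"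
    using False by (auto intro!: continuous_intros)
  moreover have "\<forall>\<^sub>F t in nhds x. ein_kernel t = (1 - exp (- t)) / t"
    using False t1_space_nhds[of x 0]
    by (auto simp: ein_kernel_def elim!: eventually_mono)
  ultimately show ?thesis
    by (simp add: isCont_cong)
qed

lemma ein_zero [simp]: "ein 0 = 0"
  by (simp add: ein_def zero_ereal_def)

lemma DERIV_ein: "(ein has_real_derivative ein_kernel x) (at x)"
proof -
  \<comment> \<open>The fundamental theorem differentiates within a closed interval; this one
    contains 0 and has \<open>x\<close> in its interior.\<close>
  define b where "b = \<bar>x\<bar> + 1"
  have b: "- b < x" "x < b" "- b \<le> 0" "0 \<le> b"
    by (auto simp: b_def)
  have "((\<lambda>u. LBINT y=ereal 0..u. ein_kernel y) has_vector_derivative ein_kernel x) (at x within {- b..b})"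
    using b by (intro interval_integral_FTC2 continuous_at_imp_continuous_on ballI isCont_ein_kernel) auto
  moreover have "at x within {- b..b} = at x"
    using b by (simp add: at_within_Icc_at)
  ultimately show ?thesis
    by (simp add: has_real_derivative_iff_has_vector_derivative zero_ereal_def ein_def[abs_def])
qed

lemmas DERIV_ein_chain [derivative_intros] = DERIV_chain2[OF DERIV_ein]

lemma ein_kernel_bounds: "0 \<le> x \<Longrightarrow> 0 \<le> ein_kernel x \<and> ein_kernel x \<le> 1"
  using exp_ge_add_one_self[of "- x"] by (auto simp: ein_kernel_def field_simps)

lemma ein_bounds:
  assumes "0 \<le> x"
  shows "0 \<le> ein x" "ein x \<le> x"
proof -
  have "ein 0 \<le> ein x"
    by (rule DERIV_nonneg_imp_nondecreasing[OF assms]) (use DERIV_ein ein_kernel_bounds in blast)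
  then show "0 \<le> ein x" by simp
  have "(\<lambda>t. t - ein t) 0 \<le> (\<lambda>t. t - ein t) x"
  proof (rule DERIV_nonneg_imp_nondecreasing[OF assms])
    fix t :: real assume "0 \<le> t"
    then show "\<exists>y. ((\<lambda>t. t - ein t) has_real_derivative y) (at t) \<and> 0 \<le> y"
      using ein_kernel_bounds[of t]
      by (intro exI[of _ "1 - ein_kernel t"]) (auto intro!: derivative_eq_intros)
  qed
  then show "ein x \<le> x" by simp
qed

section \<open>Comparison of \<open>ein\<close> with harmonic numbers\<close>

lemma exp_minus_pow_bounds:
  fixes s :: real
  assumes "0 \<le> s" "s \<le> real n" "0 < n"
  shows "(1 - s / n) ^ n \<le> exp (- s)" "exp (- s) - (1 - s / n) ^ n \<le> s\<^sup>2 * exp (- s) / n"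
proof -
  have le: "0 \<le> 1 - s / n" using assms by (simp add: field_simps)
  have "(1 - s / n) ^ n \<le> exp (- (s / n)) ^ n"
    using exp_ge_add_one_self[of "- (s / n)"] le by (intro power_mono) auto
  also have "\<dots> = exp (- s)"
    using assms by (simp flip: exp_of_nat_mult)
  finally show "(1 - s / n) ^ n \<le> exp (- s)" .
  \<comment> \<open>For the second bound, Bernoulli is applied to \<open>(1 - s^2/n^2)^n\<close>,
    which factors as \<open>(1 + s/n)^n (1 - s/n)^n\<close>; the first factor is at most
    \<open>exp s\<close>.\<close>
  have "(1 + s / n) ^ n \<le> exp (s / n) ^ n"
    using exp_ge_add_one_self[of "s / n"] assms by (intro power_mono) auto
  also have "\<dots> = exp s"
    using assms by (simp flip: exp_of_nat_mult)
  finally have e: "(1 + s / n) ^ n \<le> exp s" .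
  have "s * s \<le> real n * real n"
    using assms by (intro mult_mono) auto
  then have "1 + real n * (- (s\<^sup>2 / n\<^sup>2)) \<le> (1 + (- (s\<^sup>2 / n\<^sup>2))) ^ n"
    using assms by (intro Bernoulli_inequality) (simp add: field_simps power2_eq_square)
  also have "\<dots> = (1 + s / n) ^ n * (1 - s / n) ^ n"
    by (simp flip: power_mult_distrib) (simp add: algebra_simps power2_eq_square)
  also have "\<dots> \<le> exp s * (1 - s / n) ^ n"
    using e le by (intro mult_right_mono) auto
  finally have "1 - s\<^sup>2 / n \<le> exp s * (1 - s / n) ^ n"
    using assms by (simp add: power2_eq_square)
  then have "exp (- s) * (1 - s\<^sup>2 / n) \<le> exp (- s) * (exp s * (1 - s / n) ^ n)"
    by (intro mult_left_mono) auto
  also have "\<dots> = (1 - s / n) ^ n"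
    by (simp add: exp_minus)
  finally show "exp (- s) - (1 - s / n) ^ n \<le> s\<^sup>2 * exp (- s) / n"
    by (simp add: algebra_simps)
qed

text \<open>
  The harmonic number is the value at \<open>n\<close> of the polynomial \<open>P\<close> below, the antiderivative of
  \<open>(1 - (1 - t/n)^n) / t\<close>, which approximates the kernel of \<open>ein\<close>.
\<close>

lemma ein_minus_harm:
  assumes n: "0 < n"
  shows "\<bar>ein (real n) - harm n\<bar> \<le> 1 / n"
proof -
  define P where "P s = (\<Sum>k<n. (1 - (1 - s / n) ^ Suc k) / Suc k)" for s :: real
  define p where "p s = (\<Sum>k<n. (1 - s / n) ^ k / n)" for s :: real
  have P: "(P has_real_derivative p s) (at s)" for s
    unfolding P_def p_def using n
    by (auto intro!: derivative_eq_intros sum.cong simp del: power_Suc of_nat_Suc)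
  have p: "s * p s = 1 - (1 - s / n) ^ n" for s
    using one_diff_power_eq[of "1 - s / n" n] n by (simp add: p_def sum_divide_distrib[symmetric])
  have d: "- (s * exp (- s) / n) \<le> ein_kernel s - p s \<and> ein_kernel s - p s \<le> 0"
    if s: "0 \<le> s" "s \<le> real n" for s
  proof (cases "s = 0")
    case True
    then show ?thesis using n by (simp add: p_def ein_kernel_def)
  next
    case False
    \<comment> \<open>Multiplying by \<open>s\<close> clears both denominators, so the bounds on the
      power apply; \<open>s\<close> is cancelled afterwards.\<close>
    have eq: "s * (ein_kernel s - p s) = (1 - s / n) ^ n - exp (- s)"
      by (simp add: right_diff_distrib mult_ein_kernel p)
    have "s * (ein_kernel s - p s) \<le> s * 0" "s * (- (s * exp (- s) / n)) \<le> s * (ein_kernel s - p s)"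
      using exp_minus_pow_bounds[OF s n] unfolding eq by (auto simp: power2_eq_square)
    then show ?thesis
      using s False by (simp only: mult_le_cancel_left_pos)
  qed
  \<comment> \<open>At \<open>s = n\<close> every power \<open>(1 - s/n) ^ Suc k\<close> vanishes,
    leaving the sum of \<open>1 / Suc k\<close>.\<close>
  have P0: "P 0 = 0" and Pn: "P n = harm n"
    using n by (simp_all add: P_def harm_def sum.atLeast1_atMost_eq inverse_eq_divide)
  have "(\<lambda>s. ein s - P s) (real n) \<le> (\<lambda>s. ein s - P s) 0"
  proof (rule DERIV_nonpos_imp_nonincreasing[where f = "\<lambda>s. ein s - P s"])
    fix s :: real assume "0 \<le> s" "s \<le> real n"
    with d show "\<exists>y. ((\<lambda>s. ein s - P s) has_real_derivative y) (at s) \<and> y \<le> 0"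
      by (intro exI[of _ "ein_kernel s - p s"]) (auto intro!: derivative_eq_intros P)
  qed simp
  then have upper: "ein (real n) \<le> harm n"
    by (simp add: P0 Pn)
  \<comment> \<open>The added term has derivative \<open>s * exp (- s) / n\<close>, which offsets
    the lower bound in \<open>d\<close>. Its value at 0 is \<open>- 1 / n\<close>, the final
    error.\<close>
  let ?R = "\<lambda>s. ein s - P s - (1 + s) * exp (- s) / n"
  have "?R 0 \<le> ?R (real n)"
  proof (rule DERIV_nonneg_imp_nondecreasing[where f = ?R])
    fix s :: real assume "0 \<le> s" "s \<le> real n"
    with d[of s] n show "\<exists>y. (?R has_real_derivative y) (at s) \<and> 0 \<le> y"
      by (intro exI[of _ "ein_kernel s - p s + s * exp (- s) / n"])
        (auto intro!: derivative_eq_intros P simp: field_simps)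
  qed simp
  then have "- (1 / n) \<le> ein (real n) - harm n"
    using n by (simp add: P0 Pn) (smt (verit, ccfv_SIG) divide_nonneg_nonneg exp_ge_zero mult_nonneg_nonneg of_nat_0_le_iff)
  with upper show ?thesis by linarith
qed

section \<open>The fixed point of the recursion and its limit\<close>

lemma DERIV_mult_exp_ein:
  "((\<lambda>s. s * exp (- ein s)) has_real_derivative exp (- s) * exp (- ein s)) (at s)"
proof -
  have "((\<lambda>s. s * exp (- ein s)) has_real_derivative exp (- ein s) * (1 - s * ein_kernel s)) (at s)"
    by (auto intro!: derivative_eq_intros simp: algebra_simps)
  then show ?thesis by (simp add: mult_ein_kernel mult.commute)
qed

text \<open>Along the integers the limit follows from \<open>harm n - ln n\<close> tending to
  \<gamma>. The function is increasing, its derivative being positive, so the limit extends to real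
  arguments.\<close>

lemma mult_exp_ein_tendsto:
  "((\<lambda>s. s * exp (- ein s)) \<longlongrightarrow> exp (- euler_mascheroni)) at_top"
proof -
  have mono: "mono (\<lambda>s. s * exp (- ein s))"
  proof (rule monoI)
    fix x y :: real assume "x \<le> y"
    then show "x * exp (- ein x) \<le> y * exp (- ein y)"
      by (rule DERIV_nonneg_imp_nondecreasing) (use DERIV_mult_exp_ein in fastforce)
  qed
  have "(\<lambda>n. ein (real n) - harm n) \<longlonglongrightarrow> 0"
    by (rule Lim_null_comparison[OF _ lim_1_over_n])
      (auto intro!: eventually_mono[OF eventually_gt_at_top[of 0]] ein_minus_harm)
  from tendsto_add[OF this euler_mascheroni_LIMSEQ]
  have "(\<lambda>n. ein (real n) - ln (real n)) \<longlonglongrightarrow> euler_mascheroni" by simp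
  then have "(\<lambda>n. exp (- (ein (real n) - ln (real n)))) \<longlonglongrightarrow> exp (- euler_mascheroni)"
    by (intro tendsto_intros)
  moreover have "\<forall>\<^sub>F n in sequentially. exp (- (ein (real n) - ln (real n))) = real n * exp (- ein (real n))"
    using eventually_gt_at_top[of 0] by eventually_elim (simp add: exp_diff exp_minus field_simps)
  ultimately have "(\<lambda>n. real n * exp (- ein (real n))) \<longlonglongrightarrow> exp (- euler_mascheroni)"
    using Lim_transform_eventually by fast
  then show ?thesis
    by (intro tendsto_at_topI_sequentially_real[OF mono])
qed

section \<open>Nested denominators and their Laplace transforms\<close>

text \<open>A free starting index lets the recursion peel off the outermost variable without
  renaming the remaining ones.\<close>

definition tail_denom :: "nat \<Rightarrow> nat \<Rightarrow> (nat \<Rightarrow> real) \<Rightarrow> real" where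
  "tail_denom i n x = foldr (\<lambda>j t. 1 + x j * t) [i..<i + n] 1"

lemma tail_denom_0: "tail_denom i 0 x = 1"
  by (simp add: tail_denom_def)

lemma tail_denom_Suc: "tail_denom i (Suc n) x = 1 + x i * tail_denom (Suc i) n x"
  by (simp add: tail_denom_def upt_conv_Cons del: upt_Suc)

lemma nested_denom_conv_tail_denom: "nested_denom k x = tail_denom 1 k x"
  by (simp add: nested_denom_def tail_denom_def del: upt_Suc)

lemma tail_denom_upd: "j < i \<Longrightarrow> tail_denom i n (x(j := y)) = tail_denom i n x"
  unfolding tail_denom_def by (intro foldr_cong) auto

lemma tail_denom_ge_1:
  "(\<And>j. i \<le> j \<Longrightarrow> j < i + n \<Longrightarrow> 0 \<le> x j) \<Longrightarrow> 1 \<le> tail_denom i n x"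
proof (induction n arbitrary: i)
  case (Suc n)
  have "1 \<le> tail_denom (Suc i) n x"
    by (rule Suc.IH) (use Suc.prems in auto)
  with Suc.prems[of i] show ?case
    by (simp add: tail_denom_Suc)
qed (simp add: tail_denom_0)

lemma measurable_tail_denom:
  "{i..<i + n} \<subseteq> K \<Longrightarrow> tail_denom i n \<in> borel_measurable (\<Pi>\<^sub>M j\<in>K. lborel)"
proof (induction n arbitrary: i)
  case (Suc n)
  have [measurable]: "tail_denom (Suc i) n \<in> borel_measurable (\<Pi>\<^sub>M j\<in>K. lborel)"
    by (rule Suc.IH) (use Suc.prems in auto)
  have "i \<in> K" using Suc.prems by auto
  then have [measurable]: "(\<lambda>x. x i) \<in> borel_measurable (\<Pi>\<^sub>M j\<in>K. lborel)"
    by measurable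
  show ?case unfolding tail_denom_Suc[abs_def] by measurable
qed (simp add: tail_denom_0[abs_def])

abbreviation cube :: "nat set \<Rightarrow> (nat \<Rightarrow> real) set" where
  "cube K \<equiv> K \<rightarrow>\<^sub>E {0..1}"

lemma sets_cube: "finite K \<Longrightarrow> cube K \<in> sets (\<Pi>\<^sub>M j\<in>K. lborel)"
  by (intro sets_PiM_I_finite) auto

text \<open>Values in \<open>ennreal\<close> allow Tonelli and monotonicity arguments with no
  integrability conditions.\<close>

definition tail_laplace :: "nat \<Rightarrow> nat \<Rightarrow> real \<Rightarrow> ennreal" where
  "tail_laplace i n s = (\<integral>\<^sup>+x. indicator (cube {i..<i + n}) x *
     ennreal (exp (- s * tail_denom i n x)) \<partial>(\<Pi>\<^sub>M j\<in>{i..<i + n}. lborel))"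

lemma tail_laplace_0: "tail_laplace i 0 s = ennreal (exp (- s))"
  by (simp add: tail_laplace_def tail_denom_0 PiM_empty nn_integral_count_space_finite)

text \<open>Coordinate \<open>i\<close> is split off as the outer variable \<open>y\<close>. Since
  the denominator is \<open>1 + y D\<close> with \<open>D\<close> free of \<open>y\<close>, the
  exponential factors into \<open>exp (- s)\<close> and the transform of \<open>D\<close> at
  \<open>s * y\<close>.\<close>

lemma tail_laplace_Suc:
  "tail_laplace i (Suc n) s =
     (\<integral>\<^sup>+y. ennreal (exp (- s)) * tail_laplace (Suc i) n (s * y) * indicator {0..1} y \<partial>lborel)"
proof -
  interpret product_sigma_finite "\<lambda>_::nat. lborel :: real measure" ..
  let ?K = "{Suc i..<Suc i + n}"
  have K: "{i..<i + Suc n} = insert i ?K" by auto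
  have [measurable]: "tail_denom i (Suc n) \<in> borel_measurable (\<Pi>\<^sub>M j\<in>insert i ?K. lborel)"
    "tail_denom (Suc i) n \<in> borel_measurable (\<Pi>\<^sub>M j\<in>?K. lborel)"
    by (intro measurable_tail_denom; auto)+
  have [measurable]: "cube (insert i ?K) \<in> sets (\<Pi>\<^sub>M j\<in>insert i ?K. lborel)"
    "cube ?K \<in> sets (\<Pi>\<^sub>M j\<in>?K. lborel)"
    by (intro sets_cube; simp)+
  have "tail_laplace i (Suc n) s = (\<integral>\<^sup>+y. (\<integral>\<^sup>+x. indicator (cube (insert i ?K)) (x(i := y)) *
      ennreal (exp (- s * tail_denom i (Suc n) (x(i := y)))) \<partial>(\<Pi>\<^sub>M j\<in>?K. lborel)) \<partial>lborel)"
    unfolding tail_laplace_def K by (rule product_nn_integral_insert_rev) (simp, simp, measurable)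
  also have "\<dots> = (\<integral>\<^sup>+y. (\<integral>\<^sup>+x. ennreal (exp (- s)) * indicator {0..1} y * (indicator (cube ?K) x *
      ennreal (exp (- (s * y) * tail_denom (Suc i) n x))) \<partial>(\<Pi>\<^sub>M j\<in>?K. lborel)) \<partial>lborel)"
  proof (intro nn_integral_cong)
    fix x :: "nat \<Rightarrow> real" and y :: real
    assume "x \<in> space (\<Pi>\<^sub>M j\<in>?K. lborel)"
    then have "x(i := y) \<in> cube (insert i ?K) \<longleftrightarrow> y \<in> {0..1} \<and> x \<in> cube ?K"
      by (auto simp: space_PiM PiE_iff extensional_def split: if_splits)
    then show "indicator (cube (insert i ?K)) (x(i := y)) *
      ennreal (exp (- s * tail_denom i (Suc n) (x(i := y)))) =
      ennreal (exp (- s)) * indicator {0..1} y * (indicator (cube ?K) x *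
      ennreal (exp (- (s * y) * tail_denom (Suc i) n x)))"
      by (auto simp: indicator_def tail_denom_Suc tail_denom_upd algebra_simps
          simp flip: ennreal_mult exp_add)
  qed
  also have "\<dots> = (\<integral>\<^sup>+y. ennreal (exp (- s)) * tail_laplace (Suc i) n (s * y) * indicator {0..1} y \<partial>lborel)"
    unfolding tail_laplace_def by (subst nn_integral_cmult) (measurable, simp add: mult_ac)
  finally show ?thesis .
qed

lemma borel_measurable_exp_ein [measurable]: "(\<lambda>s. exp (- ein s)) \<in> borel_measurable borel"
proof -
  have "continuous_on UNIV ein"
    using DERIV_ein DERIV_isCont continuous_at_imp_continuous_on by blast
  then show ?thesis
    by (intro borel_measurable_continuous_onI continuous_intros)
qed

text \<open>One recursion step on the fixed point plus a linear error: \<open>c * y\<close>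
  integrates to \<open>c / 2\<close>, the source of the factor \<open>2 ^ n\<close>. The
  antiderivative involves no division by \<open>s\<close>, so \<open>s = 0\<close> is
  covered.\<close>

lemma nn_integral_exp_ein_Icc:
  assumes "0 \<le> s" "0 \<le> c"
  shows "(\<integral>\<^sup>+y. ennreal (exp (- (s * y)) * exp (- ein (s * y)) + c * y) * indicator {0..1} y \<partial>lborel)
    = ennreal (exp (- ein s) + c / 2)"
proof -
  have "((\<lambda>y. y * exp (- ein (s * y)) + c * y\<^sup>2 / 2) has_real_derivative
      exp (- (s * y)) * exp (- ein (s * y)) + c * y) (at y)" for y
  proof -
    have "((\<lambda>y. y * exp (- ein (s * y)) + c * y\<^sup>2 / 2) has_real_derivative
      exp (- ein (s * y)) * (1 - (s * y) * ein_kernel (s * y)) + c * y) (at y)"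
      by (auto intro!: derivative_eq_intros simp: algebra_simps)
    then show ?thesis
      by (simp only: mult_ein_kernel) (simp add: mult.commute)
  qed
  from nn_integral_FTC_Icc[of "\<lambda>y. exp (- (s * y)) * exp (- ein (s * y)) + c * y" 0 1, OF _ this]
  show ?thesis using assms by simp
qed

lemma tail_laplace_bounds:
  assumes "0 \<le> s"
  shows "ennreal (exp (- s) * exp (- ein s)) \<le> tail_laplace i n s \<and>
    tail_laplace i n s \<le> ennreal (exp (- s) * (exp (- ein s) + s / 2 ^ n))"
  using assms
proof (induction n arbitrary: i s)
  case 0
  \<comment> \<open>The initial error is at most \<open>s\<close>: \<open>exp (- ein s)\<close> is
    at least \<open>1 - ein s\<close>, and \<open>ein s\<close> is at most \<open>s\<close>.\<close>
  have "1 \<le> exp (- ein s) + s"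
    using exp_ge_add_one_self[of "- ein s"] ein_bounds[OF 0] by linarith
  with ein_bounds[OF 0] show ?case
    by (simp add: tail_laplace_0 ennreal_leI)
next
  case (Suc n)
  have *: "(\<integral>\<^sup>+y. ennreal (exp (- s)) * ennreal (exp (- (s * y)) * exp (- ein (s * y)) + c * y) * indicator {0..1} y \<partial>lborel)
    = ennreal (exp (- s) * (exp (- ein s) + c / 2))" if "0 \<le> c" for c
    using nn_integral_exp_ein_Icc[OF Suc.prems that] that
    by (simp add: mult.assoc nn_integral_cmult ennreal_mult)
  \<comment> \<open>The zero term makes this the instance \<open>c = 0\<close> of \<open>*\<close>;
    the upper bound uses \<open>c = s / 2 ^ n\<close>.\<close>
  have "ennreal (exp (- s) * (exp (- ein s) + 0 / 2)) \<le> tail_laplace i (Suc n) s"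
    unfolding tail_laplace_Suc *[symmetric, OF order.refl]
  proof (intro nn_integral_mono)
    fix y :: real
    show "ennreal (exp (- s)) * ennreal (exp (- (s * y)) * exp (- ein (s * y)) + 0 * y) * indicator {0..1} y
      \<le> ennreal (exp (- s)) * tail_laplace (Suc i) n (s * y) * indicator {0..1} y"
      using Suc.IH[of "s * y" "Suc i"] Suc.prems
      by (auto simp: indicator_def intro!: mult_left_mono)
  qed
  moreover have "tail_laplace i (Suc n) s \<le> ennreal (exp (- s) * (exp (- ein s) + (s / 2 ^ n) / 2))"
    unfolding tail_laplace_Suc
  proof (subst *[symmetric])
    show "0 \<le> s / 2 ^ n" using Suc.prems by simp
    show "(\<integral>\<^sup>+y. ennreal (exp (- s)) * tail_laplace (Suc i) n (s * y) * indicator {0..1} y \<partial>lborel) \<le>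
      (\<integral>\<^sup>+y. ennreal (exp (- s)) * ennreal (exp (- (s * y)) * exp (- ein (s * y)) + s / 2 ^ n * y) * indicator {0..1} y \<partial>lborel)"
    proof (intro nn_integral_mono)
      fix y :: real
      show "ennreal (exp (- s)) * tail_laplace (Suc i) n (s * y) * indicator {0..1} y \<le>
        ennreal (exp (- s)) * ennreal (exp (- (s * y)) * exp (- ein (s * y)) + s / 2 ^ n * y) * indicator {0..1} y"
      proof (cases "y \<in> {0..1}")
        case True
        then have sy: "0 \<le> s * y" using Suc.prems by simp
        have "tail_laplace (Suc i) n (s * y) \<le> ennreal (exp (- (s * y)) * (exp (- ein (s * y)) + s * y / 2 ^ n))"
          using Suc.IH[OF sy] by simp
        \<comment> \<open>The factor \<open>exp (- (s * y))\<close> on the error term is replaced by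
          1, which leaves it linear in \<open>y\<close>.\<close>
        also have "\<dots> \<le> ennreal (exp (- (s * y)) * exp (- ein (s * y)) + s / 2 ^ n * y)"
          using sy mult_right_mono[of "exp (- (s * y))" 1 "s * y / 2 ^ n"]
          by (intro ennreal_leI) (simp add: algebra_simps)
        finally show ?thesis using True by (simp add: mult_left_mono)
      qed simp
    qed
  qed
  ultimately show ?case by (simp add: mult.commute)
qed

section \<open>From Laplace transforms back to the integrals \<open>I k\<close>\<close>

lemma nn_integral_exp_atLeast_0:
  fixes N :: real
  assumes "0 < N"
  shows "(\<integral>\<^sup>+s. ennreal (exp (- s * N)) * indicator {0..} s \<partial>lborel) = ennreal (1 / N)"
proof -
  have "((\<lambda>s. - exp (- s * N) / N) \<longlongrightarrow> 0) at_top"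
    using assms by real_asymp
  then have "(\<integral>\<^sup>+s. ennreal (exp (- s * N)) * indicator {0..} s \<partial>lborel) =
      ennreal (0 - (- exp (- 0 * N) / N))"
    using assms by (intro nn_integral_FTC_atLeast) (auto intro!: derivative_eq_intros simp: field_simps)
  then show ?thesis by simp
qed

text \<open>On the cube the denominator is at least 1, so its reciprocal is the integral of
  \<open>exp (- s * D)\<close> over nonnegative \<open>s\<close>; Tonelli then swaps the two
  integrations.\<close>

lemma nn_integral_inverse_nested_denom:
  "(\<integral>\<^sup>+x. indicator (cube {1..k}) x * ennreal (1 / nested_denom k x) \<partial>(\<Pi>\<^sub>M j\<in>{1..k}. lborel))
    = (\<integral>\<^sup>+s. tail_laplace 1 k s * indicator {0..} s \<partial>lborel)"
proof -
  interpret product_sigma_finite "\<lambda>_::nat. lborel :: real measure" ..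
  let ?M = "\<Pi>\<^sub>M j\<in>{1..<1 + k}. lborel :: real measure"
  interpret F: finite_product_sigma_finite "\<lambda>_::nat. lborel :: real measure" "{1..<1 + k}" by standard simp
  interpret pair_sigma_finite ?M "lborel :: real measure" ..
  have [measurable]: "tail_denom 1 k \<in> borel_measurable ?M" "cube {1..<1 + k} \<in> sets ?M"
    by (intro measurable_tail_denom sets_cube; simp)+
  have "(\<integral>\<^sup>+x. indicator (cube {1..<1 + k}) x * ennreal (1 / nested_denom k x) \<partial>?M) =
    (\<integral>\<^sup>+x. (\<integral>\<^sup>+s. indicator (cube {1..<1 + k}) x * ennreal (exp (- s * tail_denom 1 k x)) * indicator {0..} s \<partial>lborel) \<partial>?M)"
  proof (intro nn_integral_cong)
    fix x :: "nat \<Rightarrow> real"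
    show "indicator (cube {1..<1 + k}) x * ennreal (1 / nested_denom k x) =
      (\<integral>\<^sup>+s. indicator (cube {1..<1 + k}) x * ennreal (exp (- s * tail_denom 1 k x)) * indicator {0..} s \<partial>lborel)"
    proof (cases "x \<in> cube {1..<1 + k}")
      case True
      then have "1 \<le> tail_denom 1 k x"
        by (intro tail_denom_ge_1) (auto simp: PiE_iff)
      with nn_integral_exp_atLeast_0[of "tail_denom 1 k x"] True show ?thesis
        by (simp add: nested_denom_conv_tail_denom)
    qed simp
  qed
  also have "\<dots> = (\<integral>\<^sup>+s. (\<integral>\<^sup>+x. indicator (cube {1..<1 + k}) x *
      ennreal (exp (- s * tail_denom 1 k x)) * indicator {0..} s \<partial>?M) \<partial>lborel)"
    by (rule Fubini'[symmetric]) measurable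
  also have "\<dots> = (\<integral>\<^sup>+s. tail_laplace 1 k s * indicator {0..} s \<partial>lborel)"
    unfolding tail_laplace_def by (intro nn_integral_cong nn_integral_multc) measurable
  finally show ?thesis
    by (simp add: atLeastLessThanSuc_atLeastAtMost)
qed

text \<open>The main term integrates to the limit of \<open>s * exp (- ein s)\<close>, and
  \<open>s * exp (- s)\<close> has integral 1. The cases \<open>c = 0\<close> and
  \<open>c = 1 / 2 ^ k\<close> give the two bounds on \<open>I k\<close>.\<close>

lemma nn_integral_exp_ein_atLeast_0:
  assumes "0 \<le> c"
  shows "(\<integral>\<^sup>+s. ennreal (exp (- s) * (exp (- ein s) + s * c)) * indicator {0..} s \<partial>lborel)
    = ennreal (exp (- euler_mascheroni) + c)"
proof -
  let ?F = "\<lambda>s. s * exp (- ein s) - c * ((1 + s) * exp (- s))"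
  have lim: "((\<lambda>s::real. (1 + s) * exp (- s)) \<longlongrightarrow> 0) at_top"
    using tendsto_add[OF tendsto_power_div_exp_0[of 0] tendsto_power_div_exp_0[of 1]]
    by (simp add: exp_minus field_simps)
  have "(?F \<longlongrightarrow> exp (- euler_mascheroni) - c * 0) at_top"
    by (intro tendsto_intros mult_exp_ein_tendsto lim)
  moreover have "(?F has_real_derivative exp (- s) * (exp (- ein s) + s * c)) (at s)" for s
    by (rule DERIV_cong[OF DERIV_diff[OF DERIV_mult_exp_ein]])
      (auto intro!: derivative_eq_intros simp: algebra_simps)
  ultimately have "(\<integral>\<^sup>+s. ennreal (exp (- s) * (exp (- ein s) + s * c)) * indicator {0..} s \<partial>lborel)
    = ennreal (exp (- euler_mascheroni) - c * 0 - ?F 0)"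
    using assms by (intro nn_integral_FTC_atLeast) auto
  then show ?thesis by simp
qed

lemma I_bounds:
  assumes "2 \<le> k"
  shows "exp (- euler_mascheroni) \<le> I k" "I k \<le> exp (- euler_mascheroni) + 1 / 2 ^ k"
proof -
  let ?M = "\<Pi>\<^sub>M j\<in>{1..k}. lborel :: real measure"
  let ?J = "\<integral>\<^sup>+s. tail_laplace 1 k s * indicator {0..} s \<partial>lborel"
  have [measurable]: "nested_denom k \<in> borel_measurable ?M"
    unfolding nested_denom_conv_tail_denom[abs_def] by (rule measurable_tail_denom) auto
  have [measurable]: "cube {1..k} \<in> sets ?M"
    by (intro sets_cube) simp
  have "I k = (LINT x|?M. indicator (cube {1..k}) x *\<^sub>R (1 / nested_denom k x))"
    using assms by (simp add: I_def set_lebesgue_integral_def)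
  also have "\<dots> = enn2real (\<integral>\<^sup>+x. ennreal (indicator (cube {1..k}) x *\<^sub>R (1 / nested_denom k x)) \<partial>?M)"
  proof (rule integral_eq_nn_integral)
    have "0 \<le> nested_denom k x" if "x \<in> cube {1..k}" for x
      using that tail_denom_ge_1[of 1 k x] by (fastforce simp: nested_denom_conv_tail_denom PiE_iff)
    then show "AE x in ?M. 0 \<le> indicator (cube {1..k}) x *\<^sub>R (1 / nested_denom k x)"
      by (intro AE_I2) (auto simp: indicator_def)
  qed measurable
  also have "(\<integral>\<^sup>+x. ennreal (indicator (cube {1..k}) x *\<^sub>R (1 / nested_denom k x)) \<partial>?M) =
      (\<integral>\<^sup>+x. indicator (cube {1..k}) x * ennreal (1 / nested_denom k x) \<partial>?M)"
    by (intro nn_integral_cong) (auto simp: indicator_def)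
  also have "\<dots> = ?J"
    by (rule nn_integral_inverse_nested_denom)
  finally have I: "I k = enn2real ?J" .
  have "?J \<le> (\<integral>\<^sup>+s. ennreal (exp (- s) * (exp (- ein s) + s * (1 / 2 ^ k))) * indicator {0..} s \<partial>lborel)"
    using tail_laplace_bounds by (intro nn_integral_mono) (auto simp: indicator_def)
  also have "\<dots> = ennreal (exp (- euler_mascheroni) + 1 / 2 ^ k)"
    by (rule nn_integral_exp_ein_atLeast_0) simp
  finally have upper: "?J \<le> ennreal (exp (- euler_mascheroni) + 1 / 2 ^ k)" .
  have "ennreal (exp (- euler_mascheroni) + 0) =
      (\<integral>\<^sup>+s. ennreal (exp (- s) * (exp (- ein s) + s * 0)) * indicator {0..} s \<partial>lborel)"
    by (rule nn_integral_exp_ein_atLeast_0[symmetric]) simp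
  also have "\<dots> \<le> ?J"
    using tail_laplace_bounds by (intro nn_integral_mono) (auto simp: indicator_def)
  finally have lower: "ennreal (exp (- euler_mascheroni) + 0) \<le> ?J" .
  \<comment> \<open>Since \<open>enn2real\<close> sends \<open>top\<close> to 0, it preserves the
    lower bound only once finiteness is known.\<close>
  have fin: "?J < top"
    using upper by (rule le_less_trans) simp
  show "exp (- euler_mascheroni) \<le> I k"
    using enn2real_mono[OF lower fin] by (simp add: I)
  show "I k \<le> exp (- euler_mascheroni) + 1 / 2 ^ k"
    using enn2real_mono[OF upper] by (simp add: I add_nonneg_nonneg del: ennreal_plus)
qed

theorem theorem1p4:
  shows "\<exists>C::real. \<forall>k::nat. \<bar>I k - exp (- euler_mascheroni)\<bar> \<le> C * 2 powi (- int k)"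
proof -
  \<comment> \<open>The summands cover \<open>k \<ge> 2\<close>, \<open>k = 0\<close> and
    \<open>k = 1\<close> in turn; the weight 2 offsets the factor \<open>1 / 2 ^ 1\<close>.\<close>
  define C where "C = 1 + \<bar>I 0 - exp (- euler_mascheroni)\<bar> + 2 * \<bar>I 1 - exp (- euler_mascheroni)\<bar>"
  have "\<bar>I k - exp (- euler_mascheroni)\<bar> \<le> C * (1 / 2 ^ k)" for k
  proof -
    consider "k = 0" | "k = 1" | "2 \<le> k" by linarith
    then show ?thesis
    proof cases
      case 3
      have "\<bar>I k - exp (- euler_mascheroni)\<bar> \<le> 1 * (1 / 2 ^ k)"
        using I_bounds[OF 3] by simp
      also have "\<dots> \<le> C * (1 / 2 ^ k)"
        by (intro mult_right_mono) (auto simp: C_def)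
      finally show ?thesis .
    qed (simp_all add: C_def)
  qed
  then show ?thesis
    by (intro exI[of _ C]) (simp add: power_int_minus inverse_eq_divide)
qed

end
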